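(* Let $\ell\ge 3$ be an odd integer and let $m=\lfloor \sqrt{\ell}+\tfrac{7}{2}\rfloor$. For every integer $k\ge 1$ and $n=(\ell+1)^k$, there is a completely balanced edge-coloring of $K_n$ with $\ell$ colors containing no rainbow $K_m$.
   Context: $K_n$ denotes the complete graph on $n$ vertices. An edge-coloring of $K_n$ using a set $C$ of $\ell$ colors, where $\ell$ divides $n-1$, is completely balanced if every vertex is incident to exactly $(n-1)/\ell$ edges of each color of $C$. A subgraph is rainbow if all its edges receive distinct colors. *)

theory Defs
  imports Complex_Main "HOL-Library.Ramsey"
begin

text \<open>The complete graph on a finite vertex set \<open>V\<close> has edge set \<open>nsets V 2\<close>, the set of all
  two-element subsets of \<open>V\<close>. A coloring is constrained only on these edges.\<close>

definition edge_coloring :: "'a set \<Rightarrow> 'c set \<Rightarrow> ('a set \<Rightarrow> 'c) \<Rightarrow> bool" where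
  "edge_coloring V C f \<longleftrightarrow> finite V \<and> finite C \<and> f \<in> nsets V 2 \<rightarrow> C"

text \<open>The divisibility condition makes the truncating \<open>div\<close> exact.\<close>

definition completely_balanced :: "'a set \<Rightarrow> 'c set \<Rightarrow> ('a set \<Rightarrow> 'c) \<Rightarrow> bool" where
  "completely_balanced V C f \<longleftrightarrow>
     edge_coloring V C f \<and> card C dvd card V - 1 \<and>
     (\<forall>v\<in>V. \<forall>c\<in>C. card {e \<in> nsets V 2. v \<in> e \<and> f e = c} = (card V - 1) div card C)"

definition rainbow :: "('a set \<Rightarrow> 'c) \<Rightarrow> 'a set set \<Rightarrow> bool" where
  "rainbow f E \<longleftrightarrow> inj_on f E"

definition has_rainbow_complete :: "'a set \<Rightarrow> ('a set \<Rightarrow> 'c) \<Rightarrow> nat \<Rightarrow> bool" where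
  "has_rainbow_complete V f m \<longleftrightarrow> (\<exists>S\<in>nsets V m. rainbow f (nsets S 2))"

end

theory Submission
  imports Defs "HOL-Number_Theory.Cong"
begin

text \<open>
  On \<open>\<int>/l \<union> {\<infinity>}\<close>, color \<open>{x, y}\<close> by \<open>x + y\<close> and \<open>{x, \<infinity>}\<close> by \<open>2 x\<close>; for odd \<open>l\<close> each
  vertex meets every color once. A rainbow clique avoiding \<open>\<infinity>\<close> is a weak Sidon set \<open>T\<close>. The
  differences \<open>x - y\<close> of distinct elements of \<open>T\<close> are pairwise distinct once the pairs with
  \<open>2 x - y \<in> T\<close> are discarded; each \<open>x\<close> accounts for at most two of these, so
  \<open>card T * (card T - 3) < l\<close>. If the clique contains \<open>\<infinity>\<close>, no pair has to be discarded.

  Larger \<open>k\<close> come from a lexicographic product, which creates no new rainbow cliques: two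
  vertices in the same block see any vertex outside it in the same color.
\<close>

section \<open>Color degrees counted by neighbors instead of edges\<close>

lemma card_color_neighbors:
  assumes "v \<in> V"
  shows "card {e \<in> nsets V 2. v \<in> e \<and> f e = c} = card {w \<in> V - {v}. f {v, w} = c}"
proof -
  have "bij_betw (\<lambda>w. {v, w}) {w \<in> V - {v}. f {v, w} = c} {e \<in> nsets V 2. v \<in> e \<and> f e = c}"
    unfolding bij_betw_def
  proof
    show "inj_on (\<lambda>w. {v, w}) {w \<in> V - {v}. f {v, w} = c}"
      by (auto simp: inj_on_def doubleton_eq_iff)
    show "(\<lambda>w. {v, w}) ` {w \<in> V - {v}. f {v, w} = c} = {e \<in> nsets V 2. v \<in> e \<and> f e = c}"
    proof (intro equalityI subsetI)
      fix e assume "e \<in> {e \<in> nsets V 2. v \<in> e \<and> f e = c}"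
      then obtain x y where "e = {x, y}" "x \<in> V" "y \<in> V" "x \<noteq> y" "v \<in> {x, y}" "f e = c"
        by (auto simp: nsets_2_eq)
      then show "e \<in> (\<lambda>w. {v, w}) ` {w \<in> V - {v}. f {v, w} = c}"
        by (auto simp: image_iff insert_commute)
    qed (use assms in \<open>auto simp: nsets_2_eq\<close>)
  qed
  then show ?thesis
    by (simp add: bij_betw_same_card)
qed

lemma completely_balanced_iff_neighbors:
  "completely_balanced V C f \<longleftrightarrow>
     edge_coloring V C f \<and> card C dvd card V - 1 \<and>
     (\<forall>v\<in>V. \<forall>c\<in>C. card {w \<in> V - {v}. f {v, w} = c} = (card V - 1) div card C)"
  by (simp add: completely_balanced_def card_color_neighbors)


section \<open>Lexicographic products\<close>

text \<open>The coordinates are arbitrary maps \<open>p\<close> and \<open>q\<close>, so the product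
  can live on any set in bijection with pairs, in particular on an initial segment of the naturals.
  On an edge, \<open>inj_on p e\<close> says that the endpoints lie in different blocks.\<close>

definition lex_coloring ::
  "('v \<Rightarrow> 'a) \<Rightarrow> ('v \<Rightarrow> 'b) \<Rightarrow> ('a set \<Rightarrow> 'c) \<Rightarrow> ('b set \<Rightarrow> 'c) \<Rightarrow> 'v set \<Rightarrow> 'c" where
  "lex_coloring p q f g e = (if inj_on p e then f (p ` e) else g (q ` e))"

lemma lex_coloring_doubleton:
  "v \<noteq> w \<Longrightarrow> lex_coloring p q f g {v, w} =
     (if p v = p w then g {q v, q w} else f {p v, p w})"
  by (auto simp: lex_coloring_def)

lemma completely_balanced_lex_coloring:
  assumes bij: "bij_betw (\<lambda>v. (p v, q v)) V (A \<times> B)"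
    and f: "completely_balanced A C f" and g: "completely_balanced B C g"
  shows "completely_balanced V C (lex_coloring p q f g)"
proof -
  let ?h = "lex_coloring p q f g"
  have finA: "finite A" and finB: "finite B" and finC: "finite C"
    using f g by (auto simp: completely_balanced_def edge_coloring_def)
  have finV: "finite V"
    using bij finA finB bij_betw_finite by blast
  have cardV: "card V = card A * card B"
    using bij_betw_same_card[OF bij] by (simp add: card_cartesian_product)
  have pA: "p v \<in> A" and qB: "q v \<in> B" if "v \<in> V" for v
    using bij_betwE[OF bij] that by auto
  have pq: "v = w" if "v \<in> V" "w \<in> V" "p v = p w" "q v = q w" for v w
    using bij that by (auto simp: bij_betw_def inj_on_def)
  have fC: "f {a, a'} \<in> C" if "a \<in> A" "a' \<in> A" "a \<noteq> a'" for a a'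
    using f that by (auto simp: completely_balanced_def edge_coloring_def nsets_2_eq)
  have gC: "g {b, b'} \<in> C" if "b \<in> B" "b' \<in> B" "b \<noteq> b'" for b b'
    using g that by (auto simp: completely_balanced_def edge_coloring_def nsets_2_eq)
  have col: "edge_coloring V C ?h"
    unfolding edge_coloring_def
  proof (intro conjI finV finC funcsetI)
    fix e assume "e \<in> nsets V 2"
    then obtain v w where "e = {v, w}" "v \<in> V" "w \<in> V" "v \<noteq> w"
      by (auto simp: nsets_2_eq)
    then show "?h e \<in> C"
      using pq[of v w] by (auto simp: lex_coloring_doubleton intro!: fC gC pA qB)
  qed
  obtain r where r: "card A - 1 = card C * r"
    using f by (auto simp: completely_balanced_def dvd_def)
  obtain s where s: "card B - 1 = card C * s"
    using g by (auto simp: completely_balanced_def dvd_def)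
  \<comment> \<open>Nonemptiness makes the truncated subtractions exact; with \<open>A\<close> empty
    and \<open>s > 0\<close> the identity can fail.\<close>
  have prod: "card V - 1 = card C * (r * card B + s)" if "V \<noteq> {}"
  proof -
    have "card A > 0" "card B > 0"
      using that finA finB pA qB by (auto simp: card_gt_0_iff)
    then have "card A = card C * r + 1" "card B = card C * s + 1"
      using r s by auto
    then show ?thesis
      unfolding cardV by (simp add: algebra_simps)
  qed
  have dvd: "card C dvd card V - 1"
    using prod by (cases "V = {}") auto
  have deg: "card {w \<in> V - {v}. ?h {v, w} = c} = (card V - 1) div card C"
    if v: "v \<in> V" and c: "c \<in> C" for v c
  proof -
    let ?X = "{a \<in> A - {p v}. f {p v, a} = c}" and ?Y = "{b \<in> B - {q v}. g {q v, b} = c}"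
    have C0: "card C > 0"
      using c finC by (auto simp: card_gt_0_iff)
    have X: "card ?X = r"
      using f pA[OF v] c C0 r by (simp add: completely_balanced_iff_neighbors)
    have Y: "card ?Y = s"
      using g qB[OF v] c C0 s by (simp add: completely_balanced_iff_neighbors)
    \<comment> \<open>The neighbors in color \<open>c\<close> are whole blocks chosen by
      \<open>f\<close>, plus vertices of the block of \<open>v\<close> chosen by
      \<open>g\<close>.\<close>
    have "bij_betw (\<lambda>v. (p v, q v)) {w \<in> V - {v}. ?h {v, w} = c} (?X \<times> B \<union> {p v} \<times> ?Y)"
      unfolding bij_betw_def
    proof
      show "inj_on (\<lambda>v. (p v, q v)) {w \<in> V - {v}. ?h {v, w} = c}"
        using pq by (auto simp: inj_on_def)
      show "(\<lambda>v. (p v, q v)) ` {w \<in> V - {v}. ?h {v, w} = c} = ?X \<times> B \<union> {p v} \<times> ?Y"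
      proof (intro equalityI subsetI)
        fix z assume "z \<in> (\<lambda>v. (p v, q v)) ` {w \<in> V - {v}. ?h {v, w} = c}"
        then obtain w where w: "z = (p w, q w)" "w \<in> V" "v \<noteq> w" "?h {v, w} = c"
          by auto
        then show "z \<in> ?X \<times> B \<union> {p v} \<times> ?Y"
          using pq[OF v w(2)] pA[OF w(2)] qB[OF w(2)]
          by (auto simp: lex_coloring_doubleton split: if_splits)
      next
        fix z assume z: "z \<in> ?X \<times> B \<union> {p v} \<times> ?Y"
        then have "z \<in> A \<times> B"
          using pA[OF v] by auto
        then obtain w where w: "w \<in> V" "z = (p w, q w)"
          using bij by (auto simp: bij_betw_def image_iff)
        moreover have "v \<noteq> w"
          using z w by auto
        ultimately show "z \<in> (\<lambda>v. (p v, q v)) ` {w \<in> V - {v}. ?h {v, w} = c}"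
          using z by (auto simp: lex_coloring_doubleton intro!: image_eqI[of _ _ w])
      qed
    qed
    then have "card {w \<in> V - {v}. ?h {v, w} = c} = card (?X \<times> B \<union> {p v} \<times> ?Y)"
      by (rule bij_betw_same_card)
    also have "\<dots> = card (?X \<times> B) + card ({p v} \<times> ?Y)"
      using finA finB by (intro card_Un_disjoint) auto
    also have "\<dots> = r * card B + s"
      by (simp only: card_cartesian_product X Y) simp
    also have "\<dots> = (card V - 1) div card C"
      using prod v C0 by (metis empty_iff nonzero_mult_div_cancel_left not_gr_zero)
    finally show ?thesis .
  qed
  show ?thesis
    using col dvd deg by (simp add: completely_balanced_iff_neighbors)
qed

lemma rainbow_image:
  assumes h: "rainbow h (nsets S 2)" and p: "inj_on p S"
    and hf: "\<And>v w. v \<in> S \<Longrightarrow> w \<in> S \<Longrightarrow> v \<noteq> w \<Longrightarrow> h {v, w} = f {p v, p w}"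
  shows "rainbow f (nsets (p ` S) 2)"
proof -
  have eq: "h e = f (p ` e)" if "e \<in> nsets S 2" for e
  proof -
    obtain v w where "e = {v, w}" "v \<in> S" "w \<in> S" "v \<noteq> w"
      using \<open>e \<in> nsets S 2\<close> by (auto simp: nsets_2_eq)
    then show ?thesis
      using hf by simp
  qed
  have "inj_on (f \<circ> image p) (nsets S 2)"
    using h eq unfolding rainbow_def by (subst inj_on_cong[of _ _ h]) auto
  then have "inj_on f (image p ` nsets S 2)"
    by (rule inj_on_imageI)
  moreover have "nsets (p ` S) 2 \<subseteq> image p ` nsets S 2"
  proof
    fix e assume "e \<in> nsets (p ` S) 2"
    then obtain v w where "e = p ` {v, w}" "v \<in> S" "w \<in> S" "v \<noteq> w"
      by (auto simp: nsets_2_eq)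
    then show "e \<in> image p ` nsets S 2"
      by (intro image_eqI[of _ _ "{v, w}"]) (auto simp: nsets_2_eq)
  qed
  ultimately show ?thesis
    unfolding rainbow_def by (rule inj_on_subset)
qed

text \<open>A rainbow set either meets each block at most once, and projects injectively by
  \<open>p\<close>, or lies inside one block, and projects injectively by \<open>q\<close>.\<close>

lemma has_rainbow_complete_lex_coloring:
  assumes bij: "bij_betw (\<lambda>v. (p v, q v)) V (A \<times> B)"
    and h: "has_rainbow_complete V (lex_coloring p q f g) m"
  shows "has_rainbow_complete A f m \<or> has_rainbow_complete B g m"
proof -
  let ?h = "lex_coloring p q f g"
  obtain S where S: "S \<in> nsets V m" and rb: "rainbow ?h (nsets S 2)"
    using h by (auto simp: has_rainbow_complete_def)
  have finS: "finite S" and SV: "S \<subseteq> V" and cardS: "card S = m"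
    using S by (auto simp: nsets_def)
  have pA: "p ` S \<subseteq> A" and qB: "q ` S \<subseteq> B"
    using bij_betwE[OF bij] SV by auto
  show ?thesis
  proof (cases "inj_on p S")
    case True
    then have "rainbow f (nsets (p ` S) 2)"
      by (rule rainbow_image[OF rb]) (use True in \<open>auto simp: lex_coloring_doubleton inj_on_def\<close>)
    moreover have "p ` S \<in> nsets A m"
      using pA finS cardS True by (simp add: nsets_def card_image)
    ultimately show ?thesis
      by (auto simp: has_rainbow_complete_def)
  next
    case False
    then obtain x y where xy: "x \<in> S" "y \<in> S" "x \<noteq> y" "p x = p y"
      by (auto simp: inj_on_def)
    have const: "p z = p x" if z: "z \<in> S" for z
    proof (rule ccontr)
      assume ne: "p z \<noteq> p x"
      then have zxy: "z \<noteq> x" "z \<noteq> y"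
        using xy by auto
      then have "?h {z, x} = ?h {z, y}"
        using ne xy by (simp add: lex_coloring_doubleton)
      moreover have "{z, x} \<in> nsets S 2" "{z, y} \<in> nsets S 2"
        using z xy zxy by (auto simp: nsets_2_eq)
      ultimately have "{z, x} = {z, y}"
        using rb unfolding rainbow_def by (auto dest: inj_onD)
      then show False
        using xy by (auto simp: doubleton_eq_iff)
    qed
    have injq: "inj_on q S"
    proof (rule inj_onI)
      fix v w assume "v \<in> S" "w \<in> S" "q v = q w"
      then have "(p v, q v) = (p w, q w)" "v \<in> V" "w \<in> V"
        using SV const[of v] const[of w] by auto
      then show "v = w"
        using bij by (auto simp: bij_betw_def dest: inj_onD)
    qed
    then have "rainbow g (nsets (q ` S) 2)"
      by (rule rainbow_image[OF rb]) (use const in \<open>simp add: lex_coloring_doubleton\<close>)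
    moreover have "q ` S \<in> nsets B m"
      using qB finS cardS injq by (simp add: nsets_def card_image)
    ultimately show ?thesis
      by (auto simp: has_rainbow_complete_def)
  qed
qed

text \<open>This realizes the product on natural numbers, so the type of the coloring stays the same
  throughout the induction on \<open>k\<close>.\<close>

lemma bij_betw_div_mod:
  fixes a b :: nat
  shows "bij_betw (\<lambda>v. (v div b, v mod b)) {..<a * b} ({..<a} \<times> {..<b})"
proof (rule bij_betw_byWitness[where f' = "\<lambda>(i, j). i * b + j"])
  show "(\<lambda>v. (v div b, v mod b)) ` {..<a * b} \<subseteq> {..<a} \<times> {..<b}"
    by (cases "b = 0") (auto simp: less_mult_imp_div_less)
  show "(\<lambda>(i, j). i * b + j) ` ({..<a} \<times> {..<b}) \<subseteq> {..<a * b}"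
  proof clarsimp
    fix i j assume "i < a" "j < b"
    then have "i * b + j < Suc i * b" "Suc i * b \<le> a * b"
      by (simp, intro mult_le_mono1, simp)
    then show "i * b + j < a * b"
      by linarith
  qed
qed auto


section \<open>The cyclic one-factorization\<close>

text \<open>The vertex \<open>l\<close> plays the role of \<open>\<infinity>\<close>.\<close>

definition sum_coloring :: "nat \<Rightarrow> nat set \<Rightarrow> nat" where
  "sum_coloring l e = (if l \<in> e then 2 * \<Sum>(e - {l}) else \<Sum>e) mod l"

lemma sum_coloring_finite:
  "x < l \<Longrightarrow> y < l \<Longrightarrow> x \<noteq> y \<Longrightarrow> sum_coloring l {x, y} = (x + y) mod l"
  by (simp add: sum_coloring_def)

lemma sum_coloring_infinity:
  "x < l \<Longrightarrow> sum_coloring l {x, l} = (2 * x) mod l"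
  by (simp add: sum_coloring_def insert_Diff_if)

lemma add_mod_cancel_left:
  fixes x y z l :: nat
  assumes "y < l" "z < l" "(x + y) mod l = (x + z) mod l"
  shows "y = z"
  using assms by (metis cong_add_lcancel_nat cong_def mod_less)

text \<open>Oddness makes 2 a unit modulo \<open>l\<close>. This separates the colors at infinity
  and later rules out \<open>2 * x\<close> being congruent to \<open>2 * y\<close> for distinct
  \<open>x\<close> and \<open>y\<close>.\<close>

lemma double_mod_cancel:
  fixes x y l :: nat
  assumes "odd l" "x < l" "y < l" "(2 * x) mod l = (2 * y) mod l"
  shows "x = y"
proof -
  have "coprime 2 l"
    using assms(1) by simp
  then have "[x = y] (mod l)"
    using assms(4) by (metis cong_def cong_mult_lcancel_nat)
  then show ?thesis
    using assms(2,3) by (simp add: cong_def)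
qed

lemma completely_balanced_sum_coloring:
  assumes "odd l"
  shows "completely_balanced {..<Suc l} {..<l} (sum_coloring l)"
proof -
  have l: "l > 0"
    using assms by (auto intro: odd_pos)
  have inj: "inj_on (\<lambda>w. sum_coloring l {v, w}) ({..<Suc l} - {v})" if v: "v < Suc l" for v
  proof (cases "v = l")
    case True
    have "sum_coloring l {l, w} = (2 * w) mod l" if "w < l" for w
      using sum_coloring_infinity[OF that] by (simp add: insert_commute)
    then show ?thesis
      using True by - (rule inj_onI, rule double_mod_cancel[OF assms], auto simp: less_Suc_eq)
  next
    case False
    with v have "v < l" by simp
    \<comment> \<open>Sums of \<open>v\<close> with the other finite vertices miss exactly the color
      of \<open>v + v\<close>. The edge to \<open>l\<close> supplies it, so \<open>l\<close> acts as
      a second copy of \<open>v\<close>.\<close>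
    have "sum_coloring l {v, w} = (v + (if w = l then v else w)) mod l"
      if "w < Suc l" "w \<noteq> v" for w
      using that \<open>v < l\<close> by (auto simp: sum_coloring_finite sum_coloring_infinity mult_2)
    then have "(if w = l then v else w) = (if w' = l then v else w')"
      if "w \<in> {..<Suc l} - {v}" "w' \<in> {..<Suc l} - {v}"
        "sum_coloring l {v, w} = sum_coloring l {v, w'}" for w w'
      using that \<open>v < l\<close> by - (rule add_mod_cancel_left[of _ l _ v], auto simp: less_Suc_eq)
    then show ?thesis
      by (intro inj_onI) (metis DiffD2 insertI1)
  qed
  have "card {w \<in> {..<Suc l} - {v}. sum_coloring l {v, w} = c} = 1"
    if v: "v < Suc l" and c: "c < l" for v c
  proof -
    \<comment> \<open>An injection from the \<open>l\<close> neighbors into the \<open>l\<close>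
      colors is onto.\<close>
    have "(\<lambda>w. sum_coloring l {v, w}) ` ({..<Suc l} - {v}) = {..<l}"
      using l card_image[OF inj[OF v]] v
      by (intro card_subset_eq) (auto simp: sum_coloring_def)
    then obtain w where w: "w \<in> {..<Suc l} - {v}" "sum_coloring l {v, w} = c"
      using c by (metis (no_types, lifting) imageE lessThan_iff)
    have "{w \<in> {..<Suc l} - {v}. sum_coloring l {v, w} = c} = {w}"
      using w inj_onD[OF inj[OF v]] by blast
    then show ?thesis by simp
  qed
  then show ?thesis
    using l by (auto simp: completely_balanced_iff_neighbors edge_coloring_def sum_coloring_def)
qed


section \<open>Weak Sidon sets\<close>

text \<open>The injectivity assumption is the weak Sidon property modulo \<open>l\<close>: it
  compares only sums of two distinct elements, hence the side conditions on both pairs.\<close>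

lemma weak_Sidon_eq_pair:
  fixes T :: "nat set"
  assumes "inj_on (\<lambda>e. \<Sum>e mod l) (nsets T 2)"
    and "x \<in> T" "y \<in> T" "x \<noteq> y" "z \<in> T" "w \<in> T" "z \<noteq> w"
    and "(x + y) mod l = (z + w) mod l"
  shows "{x, y} = {z, w}"
  by (rule inj_onD[OF assms(1)]) (use assms(2-) in \<open>auto simp: nsets_2_eq\<close>)

text \<open>The pairs counted are those with \<open>2 * x - y\<close> outside \<open>T\<close>
  modulo \<open>l\<close>. Equal differences \<open>x - y\<close> and \<open>x' - y'\<close> give
  equal sums \<open>x + y'\<close> and \<open>y + x'\<close>, to which the weak Sidon property
  applies unless one of these sums is a double.\<close>

lemma card_free_pairs_le:
  fixes T :: "nat set"
  assumes T: "T \<subseteq> {..<l}" and inj: "inj_on (\<lambda>e. \<Sum>e mod l) (nsets T 2)"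
  shows "card {(x, y). x \<in> T \<and> y \<in> T \<and> x \<noteq> y \<and> (\<forall>w\<in>T. (2 * x) mod l \<noteq> (y + w) mod l)} \<le> l - 1"
    (is "card ?D \<le> _")
proof -
  let ?d = "\<lambda>(x, y). (int x - int y) mod int l"
  have "inj_on ?d ?D"
  proof (rule inj_onI, clarify)
    fix x y x' y'
    assume x: "x \<in> T" and y: "y \<in> T" and "x \<noteq> y" and free: "\<forall>w\<in>T. (2 * x) mod l \<noteq> (y + w) mod l"
      and x': "x' \<in> T" and y': "y' \<in> T" and "x' \<noteq> y'"
      and free': "\<forall>w\<in>T. (2 * x') mod l \<noteq> (y' + w) mod l"
      and "(int x - int y) mod int l = (int x' - int y') mod int l"
    then have "[int x - int y + (int y + int y') = int x' - int y' + (int y + int y')] (mod int l)"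
      by (intro cong_add) (auto simp: cong_def)
    then have "[int (x + y') = int (y + x')] (mod int l)"
      by (simp add: algebra_simps)
    then have eq: "(x + y') mod l = (y + x') mod l"
      by (simp only: cong_int_iff) (simp only: cong_def)
    \<comment> \<open>If \<open>x = y'\<close>, then \<open>2 * x\<close> is congruent to
      \<open>y + x'\<close>, against \<open>free\<close> with \<open>w = x'\<close>. The case
      \<open>y = x'\<close> contradicts \<open>free'\<close> in the same way.\<close>
    have "x \<noteq> y'"
      using eq free x' by (auto simp: mult_2)
    moreover have "y \<noteq> x'"
      using eq free' x by (auto simp: mult_2 add.commute)
    ultimately have "{x, y'} = {y, x'}"
      using weak_Sidon_eq_pair[OF inj x y' _ y x' _ eq] by blast
    then show "x = x' \<and> y = y'"
      using \<open>x \<noteq> y\<close> by (auto simp: doubleton_eq_iff)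
  qed
  \<comment> \<open>Distinct residues never differ by 0, which leaves \<open>l - 1\<close>
    values.\<close>
  moreover have "?d ` ?D \<subseteq> {1..<int l}"
  proof clarsimp
    fix x y assume "x \<in> T" "y \<in> T" "x \<noteq> y"
    then have "x < l" "y < l" using T by auto
    then have "(int x - int y) mod int l \<noteq> 0"
      using \<open>x \<noteq> y\<close> \<open>x < l\<close> \<open>y < l\<close>
      by (simp add: mod_eq_0_iff_dvd mod_eq_dvd_iff[symmetric])
    then show "1 \<le> (int x - int y) mod int l \<and> (int x - int y) mod int l < int l"
      using \<open>x < l\<close> pos_mod_sign[of "int l" "int x - int y"] pos_mod_bound[of "int l" "int x - int y"]
      by linarith
  qed
  ultimately have "card ?D \<le> card {1..<int l}"
    by (intro card_inj_on_le) auto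
  then show ?thesis by simp
qed

lemma weak_Sidon_card_le:
  fixes T :: "nat set"
  assumes "odd l" and T: "T \<subseteq> {..<l}" and inj: "inj_on (\<lambda>e. \<Sum>e mod l) (nsets T 2)"
  shows "card T * (card T - 3) \<le> l - 1"
proof -
  have finT: "finite T"
    using T finite_subset by blast
  \<comment> \<open>\<open>Bad x\<close> holds the partners of \<open>x\<close> whose reflection in
    \<open>x\<close> stays in \<open>T\<close>.\<close>
  define Bad where "Bad x = {y \<in> T - {x}. \<exists>w\<in>T. (2 * x) mod l = (y + w) mod l}" for x
  have fin: "finite (Bad x)" for x
    using finT by (simp add: Bad_def)
  have ne: "y \<noteq> w" if "x \<in> T" "y \<in> Bad x" "w \<in> T" "(2 * x) mod l = (y + w) mod l" for x y w
    using that T double_mod_cancel[OF \<open>odd l\<close>, of x y] by (auto simp: Bad_def mult_2)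
  have Bad: "card (Bad x) \<le> 2" if x: "x \<in> T" for x
  proof (cases "Bad x = {}")
    case False
    then obtain y where y: "y \<in> Bad x" by blast
    then obtain w where w: "w \<in> T" "(2 * x) mod l = (y + w) mod l"
      by (auto simp: Bad_def)
    \<comment> \<open>By \<open>ne\<close>, each such representation of \<open>2 * x\<close> has
      distinct summands, so the weak Sidon property allows only one unordered pair.\<close>
    have "Bad x \<subseteq> {y, w}"
    proof
      fix y' assume y': "y' \<in> Bad x"
      then obtain w' where w': "w' \<in> T" "(2 * x) mod l = (y' + w') mod l"
        by (auto simp: Bad_def)
      have "{y', w'} = {y, w}"
        using y y' w w' ne[OF x y w] ne[OF x y' w']
        by (intro weak_Sidon_eq_pair[OF inj]) (auto simp: Bad_def)
      then show "y' \<in> {y, w}" by blast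
    qed
    then have "card (Bad x) \<le> card {y, w}"
      by (intro card_mono) auto
    also have "\<dots> \<le> 2"
      by (simp add: card_insert_if)
    finally show ?thesis .
  qed simp
  have "card T * (card T - 3) = (\<Sum>x\<in>T. card T - 3)"
    by simp
  also have "\<dots> \<le> (\<Sum>x\<in>T. card (T - {x} - Bad x))"
  proof (rule sum_mono)
    fix x assume x: "x \<in> T"
    \<comment> \<open>The 3 being subtracted counts \<open>x\<close> itself and at most two bad
      partners.\<close>
    have "card (T - {x}) - card (Bad x) \<le> card (T - {x} - Bad x)"
      using fin by (rule diff_card_le_card_Diff)
    then show "card T - 3 \<le> card (T - {x} - Bad x)"
      using Bad[OF x] x finT by simp
  qed
  also have "\<dots> = card (Sigma T (\<lambda>x. T - {x} - Bad x))"
    using finT by simp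
  also have "Sigma T (\<lambda>x. T - {x} - Bad x) =
      {(x, y). x \<in> T \<and> y \<in> T \<and> x \<noteq> y \<and> (\<forall>w\<in>T. (2 * x) mod l \<noteq> (y + w) mod l)}"
    by (auto simp: Bad_def)
  also have "card \<dots> \<le> l - 1"
    by (rule card_free_pairs_le[OF T inj])
  finally show ?thesis .
qed

text \<open>The alternatives correspond to cliques without and with the vertex \<open>l\<close>. In
  the second case \<open>T\<close> has \<open>m - 1\<close> elements and all its ordered pairs of
  distinct elements are free.\<close>

lemma rainbow_sum_coloring_bound:
  assumes "odd l" and S: "S \<in> nsets {..<Suc l} m" and rb: "rainbow (sum_coloring l) (nsets S 2)"
  shows "m * (m - 3) \<le> l - 1 \<or> (m - 1) * (m - 2) \<le> l - 1"
proof -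
  define T where "T = S - {l}"
  have finS: "finite S" and Sl: "S \<subseteq> {..<Suc l}" and cardS: "card S = m"
    using S by (auto simp: nsets_def)
  have T: "T \<subseteq> {..<l}"
    using Sl by (auto simp: T_def less_Suc_eq)
  have "inj_on (sum_coloring l) (nsets T 2)"
    using rb unfolding rainbow_def by (rule inj_on_subset) (auto simp: T_def nsets_def)
  moreover have "sum_coloring l e = \<Sum>e mod l" if "e \<in> nsets T 2" for e
    using that by (auto simp: nsets_def sum_coloring_def T_def)
  ultimately have inj: "inj_on (\<lambda>e. \<Sum>e mod l) (nsets T 2)"
    by (simp cong: inj_on_cong)
  show ?thesis
  proof (cases "l \<in> S")
    case False
    then show ?thesis
      using weak_Sidon_card_le[OF \<open>odd l\<close> T inj] cardS by (simp add: T_def)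
  next
    case True
    have free: "(2 * x) mod l \<noteq> (y + w) mod l" if xyw: "x \<in> T" "y \<in> T" "x \<noteq> y" "w \<in> T" for x y w
    proof
      assume eq: "(2 * x) mod l = (y + w) mod l"
      have lt: "x < l" "y < l" "w < l"
        using T xyw by auto
      have "y \<noteq> w"
        using eq double_mod_cancel[OF \<open>odd l\<close>, of x y] lt xyw by (auto simp: mult_2)
      \<comment> \<open>The edge to infinity already uses the color \<open>2 * x\<close>, so no edge
        inside \<open>T\<close> may repeat it.\<close>
      then have "sum_coloring l {x, l} = sum_coloring l {y, w}"
        using eq lt by (simp add: sum_coloring_infinity sum_coloring_finite)
      moreover have "{x, l} \<in> nsets S 2" "{y, w} \<in> nsets S 2"
        using True xyw \<open>y \<noteq> w\<close> by (auto simp: T_def nsets_2_eq)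
      ultimately have "{x, l} = {y, w}"
        using rb unfolding rainbow_def by (auto dest: inj_onD)
      then show False
        using lt by (auto simp: doubleton_eq_iff)
    qed
    have cardT: "card T = m - 1"
      using True cardS finS by (simp add: T_def)
    have "card T * (card T - 1) = card (Sigma T (\<lambda>x. T - {x}))"
      using finS by (simp add: T_def)
    also have "Sigma T (\<lambda>x. T - {x}) =
        {(x, y). x \<in> T \<and> y \<in> T \<and> x \<noteq> y \<and> (\<forall>w\<in>T. (2 * x) mod l \<noteq> (y + w) mod l)}"
      using free by auto
    also have "card \<dots> \<le> l - 1"
      by (rule card_free_pairs_le[OF T inj])
    finally show ?thesis
      by (simp add: cardT numeral_2_eq_2)
  qed
qed

section \<open>Choice of the clique order and induction on the exponent\<close>

lemma floor_sqrt_bound: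
  fixes l m :: nat
  assumes "l \<ge> 3" and m: "m = nat \<lfloor>sqrt (real l) + 7 / 2\<rfloor>"
  shows "m \<ge> 5" and "l \<le> (m - 2) * (m - 3)"
proof -
  have s: "sqrt (real l) \<ge> 3 / 2"
    using assms(1) by (intro real_le_rsqrt) (simp add: power2_eq_square)
  then have "\<lfloor>sqrt (real l) + 7 / 2\<rfloor> \<ge> 5"
    by (simp add: le_floor_iff)
  then show m5: "m \<ge> 5"
    using m by linarith
  have "real m > sqrt (real l) + 5 / 2"
    using m s by linarith
  then have "sqrt (real l) < real m - 5 / 2" by simp
  then have "(sqrt (real l))\<^sup>2 < (real m - 5 / 2)\<^sup>2"
    by (intro power_strict_mono) auto
  \<comment> \<open>Completing the square: \<open>(m - 5/2)^2 = (m - 2) * (m - 3) + 1/4\<close>. The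
    surplus 1/4 disappears because both sides of the final bound are integers.\<close>
  then have "real l < (real m - 2) * (real m - 3) + 1 / 4"
    by (simp add: power2_eq_square algebra_simps)
  also have "(real m - 2) * (real m - 3) = real ((m - 2) * (m - 3))"
    using m5 by (simp add: of_nat_diff)
  finally show "l \<le> (m - 2) * (m - 3)"
    by linarith
qed

lemma no_rainbow_sum_coloring:
  assumes "l \<ge> 3" "odd l" and "m = nat \<lfloor>sqrt (real l) + 7 / 2\<rfloor>"
  shows "\<not> has_rainbow_complete {..<Suc l} (sum_coloring l) m"
proof
  assume "has_rainbow_complete {..<Suc l} (sum_coloring l) m"
  then have "m * (m - 3) \<le> l - 1 \<or> (m - 1) * (m - 2) \<le> l - 1"
    using rainbow_sum_coloring_bound[OF \<open>odd l\<close>] by (auto simp: has_rainbow_complete_def)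
  moreover have "l \<le> (m - 2) * (m - 3)"
    using floor_sqrt_bound[OF assms(1,3)] by simp
  \<comment> \<open>Both products from the counting bound dominate \<open>(m - 2) * (m - 3)\<close>,
    hence are at least \<open>l\<close>.\<close>
  moreover have "(m - 2) * (m - 3) \<le> m * (m - 3)"
    by (intro mult_le_mono) auto
  moreover have "(m - 2) * (m - 3) \<le> (m - 1) * (m - 2)"
    by (subst mult.commute, intro mult_le_mono) auto
  ultimately show False
    using assms(1) by linarith
qed

theorem theorem4:
  fixes l m k n :: nat
  assumes "l \<ge> 3" and "odd l"
    and "m = nat \<lfloor>sqrt (real l) + 7 / 2\<rfloor>"
    and "k \<ge> 1" and "n = (l + 1) ^ k"
  shows "\<exists>f :: nat set \<Rightarrow> nat.
           completely_balanced {..<n} {..<l} f \<and> \<not> has_rainbow_complete {..<n} f m"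
proof -
  have base: "completely_balanced {..<l + 1} {..<l} (sum_coloring l)"
      "\<not> has_rainbow_complete {..<l + 1} (sum_coloring l) m"
    using completely_balanced_sum_coloring[OF assms(2)] no_rainbow_sum_coloring[OF assms(1-3)]
    by simp_all
  have "\<exists>f :: nat set \<Rightarrow> nat. completely_balanced {..<(l + 1) ^ k} {..<l} f \<and>
          \<not> has_rainbow_complete {..<(l + 1) ^ k} f m"
    using \<open>k \<ge> 1\<close>
  proof (induction k rule: nat_induct_at_least)
    case base
    then show ?case
      using \<open>completely_balanced _ _ _\<close> \<open>\<not> has_rainbow_complete _ _ _\<close> by auto
  next
    case (Suc k)
    then obtain f :: "nat set \<Rightarrow> nat" where f: "completely_balanced {..<(l + 1) ^ k} {..<l} f"
        "\<not> has_rainbow_complete {..<(l + 1) ^ k} f m"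
      by blast
    \<comment> \<open>The last digit in base \<open>l + 1\<close> is the position inside a block,
      colored by \<open>sum_coloring l\<close>; the remaining digits name the block, colored by the
      inductive \<open>f\<close>.\<close>
    have bij: "bij_betw (\<lambda>v. (v div (l + 1), v mod (l + 1))) {..<(l + 1) ^ Suc k}
        ({..<(l + 1) ^ k} \<times> {..<l + 1})"
      using bij_betw_div_mod[of "l + 1" "(l + 1) ^ k"] by (simp add: mult.commute)
    show ?case
      using completely_balanced_lex_coloring[OF bij f(1) base(1)]
        has_rainbow_complete_lex_coloring[OF bij] f(2) base(2) by blast
  qed
  then show ?thesis
    using assms(5) by simp
qed

end
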